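(* Let $K$ be a compact Polish space, let $\mathbb{H}\subset[0,\infty)^K$ be a Polish space of functions, and let $H$ be a locally finite measure on $\mathbb{H}$ with $\int_{\mathbb{H}} f(y)\,H(\mathrm{d}f)=1$ for all $y\in K$. Let $$Z(y)=\max_{(t,f)\in\Pi} t f(y),\qquad y\in K,$$ where $\Pi$ is a Poisson point process on $(0,\infty)\times\mathbb{H}$ with intensity measure $t^{-2}\,\mathrm{d}t\,H(\mathrm{d}f)$. Let $g$ be a probability density on $\mathbb{H}$ with respect to $H$, i.e. $g\ge 0$ and $\int_{\mathbb{H}} g(f)\,H(\mathrm{d}f)=1$, such that $$H\Big(\Big\{f:\ g(f)=0,\ \sup_{y\in K} f(y)>0\Big\}\Big)=0 .$$ Then $$Z(y)=^d\max_{(t,f)\in\tilde\Pi} t\,\frac{f(y)}{g(f)},\qquad y\in K,$$ where $\tilde\Pi$ is a Poisson point process on $(0,\infty)\times\mathbb{H}$ with intensity measure $t^{-2}\,\mathrm{d}t\,g(f)\,H(\mathrm{d}f)$.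
   Context: $Z$ is a max-stable process with standard Fréchet margins and the $f\in\mathbb{H}$ are its spectral functions. Maxima over infinite point sets are suprema. The evaluation maps $f\mapsto f(y)$ are measurable on $\mathbb{H}$. The symbol $=^d$ denotes equality of all finite-dimensional distributions of the two processes indexed by $K$. Functions $f$ with $g(f)=0$ almost surely do not occur in $\tilde\Pi$, so the quotient $f(y)/g(f)$ is almost surely well defined at all points of $\tilde\Pi$. *)

theory Defs
  imports "HOL-Probability.Probability"
begin

text \<open>
  The space of spectral functions carries its own Polish topology, which need not be the
  topology of the function type, so it is given as an abstract topology.
\<close>

definition polish_topology :: "'a topology \<Rightarrow> bool" where
  "polish_topology T \<longleftrightarrow> completely_metrizable_space T \<and> second_countable T"

definition borel_of :: "'a topology \<Rightarrow> 'a measure" where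
  "borel_of T = sigma (topspace T) {U. openin T U}"

definition locally_finite_measure_on :: "'a topology \<Rightarrow> 'a measure \<Rightarrow> bool" where
  "locally_finite_measure_on T H \<longleftrightarrow>
     sets H = sets (borel_of T) \<and>
     (\<forall>x\<in>topspace T. \<exists>U. openin T U \<and> x \<in> U \<and> emeasure H U < \<infinity>)"

definition inverse_square_measure :: "real measure" where
  "inverse_square_measure =
     density (restrict_space lborel {0<..}) (\<lambda>t. ennreal (1 / t\<^sup>2))"

definition point_count :: "('w \<Rightarrow> 'a set) \<Rightarrow> 'a set \<Rightarrow> 'w \<Rightarrow> ennreal" where
  "point_count P A \<omega> = emeasure (count_space UNIV) (P \<omega> \<inter> A)"

text \<open>
  A Poisson point process is a random countable set of points. Sets of infinite intensity
  contain infinitely many points almost surely. A random set has no multiple points; this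
  costs nothing for the intensities used here, since their first factor has no atoms.
\<close>

definition poisson_point_process ::
  "'w measure \<Rightarrow> ('w \<Rightarrow> 'a set) \<Rightarrow> 'a measure \<Rightarrow> bool" where
  "poisson_point_process M P \<mu> \<longleftrightarrow>
     prob_space M \<and>
     (\<forall>\<omega>\<in>space M. countable (P \<omega>) \<and> P \<omega> \<subseteq> space \<mu>) \<and>
     (\<forall>A\<in>sets \<mu>. point_count P A \<in> borel_measurable M) \<and>
     (\<forall>A\<in>sets \<mu>. emeasure \<mu> A < \<infinity> \<longrightarrow>
        (\<forall>k::nat. measure M {\<omega>\<in>space M. point_count P A \<omega> = of_nat k} =
                  exp (- measure \<mu> A) * measure \<mu> A ^ k / fact k)) \<and>
     (\<forall>A\<in>sets \<mu>. emeasure \<mu> A = \<infinity> \<longrightarrow> (AE \<omega> in M. point_count P A \<omega> = \<infinity>)) \<and>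
     (\<forall>(n::nat) A. (\<forall>i<n. A i \<in> sets \<mu>) \<and> disjoint_family_on A {..<n} \<longrightarrow>
        prob_space.indep_vars M (\<lambda>_. borel) (\<lambda>i. point_count P (A i)) {..<n})"

text \<open>
  Measurability is part of the definition because \<^const>\<open>distr\<close> is not meaningful
  for non-measurable maps.
\<close>

definition eq_fdd ::
  "'k set \<Rightarrow> 'w measure \<Rightarrow> ('k \<Rightarrow> 'w \<Rightarrow> ennreal) \<Rightarrow> 'v measure \<Rightarrow> ('k \<Rightarrow> 'v \<Rightarrow> ennreal) \<Rightarrow> bool" where
  "eq_fdd K M X N Y \<longleftrightarrow>
     (\<forall>y\<in>K. X y \<in> borel_measurable M) \<and>
     (\<forall>y\<in>K. Y y \<in> borel_measurable N) \<and>
     (\<forall>J. finite J \<and> J \<subseteq> K \<longrightarrow>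
        distr M (PiM J (\<lambda>_. borel)) (\<lambda>\<omega>. \<lambda>y\<in>J. X y \<omega>) =
        distr N (PiM J (\<lambda>_. borel)) (\<lambda>\<omega>. \<lambda>y\<in>J. Y y \<omega>))"

end

theory Submission
  imports Defs
begin

text \<open>
  The events \<open>{Z y \<le> x y for all y \<in> J}\<close> form a \<open>\<pi>\<close>-system generating the finite-dimensional
  distributions, and each of them says that the point process has no point in a set. Its
  probability is therefore determined by the intensity of that set, and it remains to compare
  intensities. In each fibre over a spectral function \<open>f\<close> with \<open>g f > 0\<close>, the factor \<open>g f\<close> is
  absorbed by the substitution \<open>t = g f * s\<close>, because \<open>t\<^sup>-\<^sup>2 dt = (g f)\<^sup>-\<^sup>1 s\<^sup>-\<^sup>2 ds\<close>.
\<close>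

section \<open>Laws of finite families of random variables\<close>

lemma borel_eq_sigma_atMost:
  "borel = sigma UNIV (range atMost :: 'a::{linorder_topology, second_countable_topology} set set)"
  unfolding borel_Ioi
proof (rule sigma_eqI)
  show "sigma_sets UNIV (range greaterThan :: 'a set set) = sigma_sets UNIV (range atMost)"
  proof (rule sigma_sets_eqI)
    fix A :: "'a set" assume "A \<in> range greaterThan"
    then obtain x where "A = UNIV - {..x}" by (auto simp: Compl_eq_Diff_UNIV[symmetric])
    then show "A \<in> sigma_sets UNIV (range atMost)"
      by (auto intro: sigma_sets.Compl)
  next
    fix A :: "'a set" assume "A \<in> range atMost"
    then obtain x where "A = UNIV - {x<..}" by (auto simp: Compl_eq_Diff_UNIV[symmetric])
    then show "A \<in> sigma_sets UNIV (range greaterThan)"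
      by (auto intro: sigma_sets.Compl)
  qed
qed auto

text \<open>The multivariate form of the fact that a distribution function determines its law. Lower
  boxes intersect in a lower box, by coordinatewise minimum in the linear order, and they generate
  the product sigma-algebra. A greatest element makes the whole product a lower box too, so no
  exhausting sequence has to be built.\<close>

lemma distr_PiM_eq_atMostI:
  fixes X :: "'i \<Rightarrow> 'a \<Rightarrow> 'c::{linorder_topology, second_countable_topology, order_top}"
  assumes "prob_space M" "prob_space N" "finite J"
    and X: "\<And>i. i \<in> J \<Longrightarrow> X i \<in> borel_measurable M"
    and Y: "\<And>i. i \<in> J \<Longrightarrow> Y i \<in> borel_measurable N"
    and eq: "\<And>x. measure M {\<omega> \<in> space M. \<forall>i\<in>J. X i \<omega> \<le> x i} =
      measure N {\<omega> \<in> space N. \<forall>i\<in>J. Y i \<omega> \<le> x i}"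
  shows "distr M (PiM J (\<lambda>_. borel)) (\<lambda>\<omega>. \<lambda>i\<in>J. X i \<omega>) =
    distr N (PiM J (\<lambda>_. borel)) (\<lambda>\<omega>. \<lambda>i\<in>J. Y i \<omega>)"
    (is "?D = ?E")
proof -
  interpret M: prob_space M by fact
  interpret N: prob_space N by fact
  let ?\<Omega> = "PiE J (\<lambda>_. UNIV :: 'c set)"
  let ?P = "range (\<lambda>x. {f \<in> ?\<Omega>. \<forall>i\<in>J. f i \<le> x i})"
  have Xm: "(\<lambda>\<omega>. \<lambda>i\<in>J. X i \<omega>) \<in> M \<rightarrow>\<^sub>M PiM J (\<lambda>_. borel)"
    and Ym: "(\<lambda>\<omega>. \<lambda>i\<in>J. Y i \<omega>) \<in> N \<rightarrow>\<^sub>M PiM J (\<lambda>_. borel)"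
    using X Y by (auto intro!: measurable_restrict)
  have gen: "sets (PiM J (\<lambda>_. borel)) = sigma_sets ?\<Omega> ?P"
  proof -
    \<comment> \<open>This is the shape that \<open>sets_PiM_sigma\<close> expects, where
      \<open>j\<close> ranges over a family of finite index sets with union \<open>J\<close>; here
      the family is the singleton \<open>{J}\<close>.\<close>
    have P: "?P = {{f \<in> ?\<Omega>. \<forall>i\<in>j. f i \<in> A i} | A j. j \<in> {J} \<and> A \<in> Pi j (\<lambda>_. range atMost)}"
    proof (intro set_eqI iffI)
      fix B assume "B \<in> ?P"
      then obtain x where x: "B = {f \<in> ?\<Omega>. \<forall>i\<in>J. f i \<le> x i}" by auto
      show "B \<in> {{f \<in> ?\<Omega>. \<forall>i\<in>j. f i \<in> A i} | A j. j \<in> {J} \<and> A \<in> Pi j (\<lambda>_. range atMost)}"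
        unfolding x by (intro CollectI exI[of _ "\<lambda>i. {..x i}"] exI[of _ J]) auto
    next
      fix B assume "B \<in> {{f \<in> ?\<Omega>. \<forall>i\<in>j. f i \<in> A i} | A j. j \<in> {J} \<and> A \<in> Pi j (\<lambda>_. range atMost)}"
      then obtain A where B: "B = {f \<in> ?\<Omega>. \<forall>i\<in>J. f i \<in> A i}" and "A \<in> Pi J (\<lambda>_. range atMost)"
        by auto
      then have "\<forall>i\<in>J. \<exists>x. A i = {..x}" by auto
      then obtain x where "\<forall>i\<in>J. A i = {..x i}" by metis
      then have "B = {f \<in> ?\<Omega>. \<forall>i\<in>J. f i \<le> x i}" using B by auto
      then show "B \<in> ?P" by auto
    qed
    \<comment> \<open>The required countable cover of each factor by generators is the single set
      \<open>{..top}\<close>. As \<open>borel_eq_sigma_atMost\<close> equates measures and not only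
      their sets, it can afterwards be rewritten inside the product.\<close>
    have "sets (PiM J (\<lambda>_. sigma UNIV (range atMost :: 'c set set))) = sets (sigma ?\<Omega> ?P)"
      unfolding P
      by (rule sets_PiM_sigma) (use \<open>finite J\<close> in \<open>auto intro!: exI[of _ "{{..top}}"]\<close>)
    then show ?thesis
      by (simp add: borel_eq_sigma_atMost[symmetric] sets_measure_of subset_eq)
  qed
  have boxes: "{f \<in> ?\<Omega>. \<forall>i\<in>J. f i \<le> x i} \<in> sets (PiM J (\<lambda>_. borel))" for x
    unfolding gen by (auto intro: sigma_sets.Basic)
  show ?thesis
  proof (rule measure_eqI_generator_eq[where E = ?P and \<Omega> = ?\<Omega> and A = "\<lambda>_. ?\<Omega>"])
    show "Int_stable ?P"
    proof (rule Int_stableI)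
      fix A B assume "A \<in> ?P" "B \<in> ?P"
      then obtain x z where "A = {f \<in> ?\<Omega>. \<forall>i\<in>J. f i \<le> x i}" "B = {f \<in> ?\<Omega>. \<forall>i\<in>J. f i \<le> z i}"
        by auto
      then have "A \<inter> B = {f \<in> ?\<Omega>. \<forall>i\<in>J. f i \<le> min (x i) (z i)}" by auto
      then show "A \<inter> B \<in> ?P" by (intro range_eqI[of _ _ "\<lambda>i. min (x i) (z i)"])
    qed
    show "?P \<subseteq> Pow ?\<Omega>" by auto
    show "sets ?D = sigma_sets ?\<Omega> ?P" "sets ?E = sigma_sets ?\<Omega> ?P" by (simp_all add: gen)
    have "?\<Omega> = {f \<in> ?\<Omega>. \<forall>i\<in>J. f i \<le> top}" by auto
    then show "range (\<lambda>_::nat. ?\<Omega>) \<subseteq> ?P" by (auto intro!: image_eqI[of _ _ "\<lambda>_. top"])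
    show "(\<Union>i::nat. ?\<Omega>) = ?\<Omega>" by simp
    show "emeasure ?D ?\<Omega> \<noteq> \<infinity>"
      using M.prob_space_distr[OF Xm] prob_space.finite_measure finite_measure.emeasure_finite
      by (metis infinity_ennreal_def)
  next
    fix B assume "B \<in> ?P"
    then obtain x where B: "B = {f \<in> ?\<Omega>. \<forall>i\<in>J. f i \<le> x i}" by auto
    have "emeasure ?D B = emeasure M {\<omega> \<in> space M. \<forall>i\<in>J. X i \<omega> \<le> x i}"
      unfolding B by (subst emeasure_distr[OF Xm boxes]) (auto intro!: arg_cong[where f = "emeasure M"])
    moreover have "emeasure ?E B = emeasure N {\<omega> \<in> space N. \<forall>i\<in>J. Y i \<omega> \<le> x i}"
      unfolding B by (subst emeasure_distr[OF Ym boxes]) (auto intro!: arg_cong[where f = "emeasure N"])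
    ultimately show "emeasure ?D B = emeasure ?E B"
      by (simp add: M.emeasure_eq_measure N.emeasure_eq_measure eq)
  qed
qed

section \<open>Suprema over Poisson point processes\<close>

lemma SUP_le_iff_point_count_eq_0:
  fixes \<phi> :: "'i \<Rightarrow> 'a \<Rightarrow> ennreal"
  assumes "P \<omega> \<subseteq> S"
  shows "(\<forall>i\<in>J. (SUP p\<in>P \<omega>. \<phi> i p) \<le> x i) \<longleftrightarrow>
    point_count P {p \<in> S. \<exists>i\<in>J. x i < \<phi> i p} \<omega> = 0"
proof -
  have "(\<forall>i\<in>J. (SUP p\<in>P \<omega>. \<phi> i p) \<le> x i) \<longleftrightarrow> P \<omega> \<inter> {p \<in> S. \<exists>i\<in>J. x i < \<phi> i p} = {}"
    unfolding SUP_le_iff disjoint_iff mem_Collect_eq using assms by (meson not_less subsetD)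
  then show ?thesis by (simp add: point_count_def emeasure_count_space_eq_0)
qed

text \<open>The finite case is the Poisson law at \<open>k = 0\<close>. Infinite intensity is kept
  apart because \<open>measure\<close> sends infinity to 0, so the exponential would give 1 instead
  of the correct value 0.\<close>

lemma poisson_point_process_void_probability:
  assumes P: "poisson_point_process M P \<mu>" and A: "A \<in> sets \<mu>"
  shows "measure M {\<omega> \<in> space M. point_count P A \<omega> = 0} =
    (if emeasure \<mu> A = \<infinity> then 0 else exp (- measure \<mu> A))"
proof (cases "emeasure \<mu> A = \<infinity>")
  case True
  with P A have "AE \<omega> in M. point_count P A \<omega> = \<infinity>"
    unfolding poisson_point_process_def by blast
  then have "AE \<omega> in M. \<not> point_count P A \<omega> = 0" by eventually_elim simp
  then have "emeasure M {\<omega> \<in> space M. point_count P A \<omega> = 0} = 0"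
    by (rule emeasure_eq_0_AE)
  then show ?thesis using True by (simp add: measure_def)
next
  case False
  then have fin: "emeasure \<mu> A < \<infinity>" by (simp add: top.not_eq_extremum)
  have "measure M {\<omega> \<in> space M. point_count P A \<omega> = of_nat k} =
      exp (- measure \<mu> A) * measure \<mu> A ^ k / fact k" for k :: nat
    using P A fin unfolding poisson_point_process_def by blast
  from this[of 0] show ?thesis using False by simp
qed

text \<open>The index set of the supremum is random, so closure of measurability under countable
  suprema does not apply directly. Instead, every sublevel event says that a fixed measurable set
  contains no point, and point counts are measurable by definition.\<close>

lemma borel_measurable_SUP_poisson_point_process:
  fixes \<phi> :: "'a \<Rightarrow> ennreal"
  assumes P: "poisson_point_process M P \<mu>" and \<phi>: "\<phi> \<in> borel_measurable \<mu>"
  shows "(\<lambda>\<omega>. SUP p\<in>P \<omega>. \<phi> p) \<in> borel_measurable M"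
proof (rule borel_measurableI_le)
  fix x
  \<comment> \<open>The dummy index \<open>()\<close> brings the single bound into the form of
    \<open>SUP_le_iff_point_count_eq_0\<close>.\<close>
  let ?A = "{p \<in> space \<mu>. \<exists>i\<in>{()}. x < \<phi> p}"
  have "?A \<in> sets \<mu>" using \<phi> by measurable
  then have [measurable]: "point_count P ?A \<in> borel_measurable M"
    using P unfolding poisson_point_process_def by blast
  have "P \<omega> \<subseteq> space \<mu>" if "\<omega> \<in> space M" for \<omega>
    using P that unfolding poisson_point_process_def by blast
  from SUP_le_iff_point_count_eq_0[of P _ "space \<mu>" "{()}" "\<lambda>_. \<phi>" "\<lambda>_. x", OF this]
  have "{\<omega> \<in> space M. (SUP p\<in>P \<omega>. \<phi> p) \<le> x} = {\<omega> \<in> space M. point_count P ?A \<omega> = 0}"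
    by auto
  also have "\<dots> \<in> sets M" by measurable
  finally show "{\<omega> \<in> space M. (SUP p\<in>P \<omega>. \<phi> p) \<le> x} \<in> sets M" .
qed

text \<open>Reduces equality in law to a comparison of intensities of exceedance sets. The two
  processes may live on different probability spaces and have different spaces of points. The
  intensities may be infinite.\<close>

lemma eq_fdd_SUP_poisson_point_process:
  fixes \<phi> :: "'k \<Rightarrow> 'a \<Rightarrow> ennreal" and \<psi> :: "'k \<Rightarrow> 'b \<Rightarrow> ennreal"
  assumes P: "poisson_point_process M P \<mu>" and Q: "poisson_point_process N Q \<nu>"
    and \<phi>[measurable]: "\<And>y. y \<in> K \<Longrightarrow> \<phi> y \<in> borel_measurable \<mu>"
    and \<psi>[measurable]: "\<And>y. y \<in> K \<Longrightarrow> \<psi> y \<in> borel_measurable \<nu>"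
    and eq: "\<And>J x. finite J \<Longrightarrow> J \<subseteq> K \<Longrightarrow>
      emeasure \<mu> {p \<in> space \<mu>. \<exists>y\<in>J. x y < \<phi> y p} = emeasure \<nu> {q \<in> space \<nu>. \<exists>y\<in>J. x y < \<psi> y q}"
  shows "eq_fdd K M (\<lambda>y \<omega>. SUP p\<in>P \<omega>. \<phi> y p) N (\<lambda>y \<omega>. SUP q\<in>Q \<omega>. \<psi> y q)"
  unfolding eq_fdd_def
proof (intro conjI ballI allI impI)
  show "(\<lambda>\<omega>. SUP p\<in>P \<omega>. \<phi> y p) \<in> borel_measurable M" if "y \<in> K" for y
    by (rule borel_measurable_SUP_poisson_point_process[OF P \<phi>[OF that]])
  show "(\<lambda>\<omega>. SUP q\<in>Q \<omega>. \<psi> y q) \<in> borel_measurable N" if "y \<in> K" for y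
    by (rule borel_measurable_SUP_poisson_point_process[OF Q \<psi>[OF that]])
  fix J assume "finite J \<and> J \<subseteq> K"
  then have J: "finite J" "J \<subseteq> K" by auto
  \<comment> \<open>Stated for an arbitrary process with its own types, so that it can be
    instantiated for both \<open>P\<close> and \<open>Q\<close>.\<close>
  have void: "measure M' {\<omega> \<in> space M'. \<forall>y\<in>J. (SUP p\<in>P' \<omega>. \<theta> y p) \<le> x y} =
      (if emeasure \<kappa> {p \<in> space \<kappa>. \<exists>y\<in>J. x y < \<theta> y p} = \<infinity> then 0
       else exp (- measure \<kappa> {p \<in> space \<kappa>. \<exists>y\<in>J. x y < \<theta> y p}))"
    if P': "poisson_point_process M' P' \<kappa>" and \<theta>: "\<And>y. y \<in> K \<Longrightarrow> \<theta> y \<in> borel_measurable \<kappa>"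
    for M' :: "'m measure" and P' and \<kappa> :: "'p measure" and \<theta> :: "'k \<Rightarrow> 'p \<Rightarrow> ennreal" and x
  proof -
    let ?A = "{p \<in> space \<kappa>. \<exists>y\<in>J. x y < \<theta> y p}"
    have "?A = (\<Union>y\<in>J. {p \<in> space \<kappa>. x y < \<theta> y p})" by auto
    also have "\<dots> \<in> sets \<kappa>"
    proof (rule sets.finite_UN[OF J(1)])
      fix y assume "y \<in> J"
      then have [measurable]: "\<theta> y \<in> borel_measurable \<kappa>" using J \<theta> by blast
      show "{p \<in> space \<kappa>. x y < \<theta> y p} \<in> sets \<kappa>" by measurable
    qed
    finally have A: "?A \<in> sets \<kappa>" .
    have "P' \<omega> \<subseteq> space \<kappa>" if "\<omega> \<in> space M'" for \<omega>
      using P' that unfolding poisson_point_process_def by blast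
    then have "{\<omega> \<in> space M'. \<forall>y\<in>J. (SUP p\<in>P' \<omega>. \<theta> y p) \<le> x y} =
        {\<omega> \<in> space M'. point_count P' ?A \<omega> = 0}"
      by (intro Collect_cong conj_cong refl SUP_le_iff_point_count_eq_0)
    then show ?thesis
      by (simp only: poisson_point_process_void_probability[OF P' A])
  qed
  show "distr M (PiM J (\<lambda>_. borel)) (\<lambda>\<omega>. \<lambda>y\<in>J. SUP p\<in>P \<omega>. \<phi> y p) =
      distr N (PiM J (\<lambda>_. borel)) (\<lambda>\<omega>. \<lambda>y\<in>J. SUP q\<in>Q \<omega>. \<psi> y q)"
  proof (rule distr_PiM_eq_atMostI)
    show "prob_space M" "prob_space N" using P Q unfolding poisson_point_process_def by auto
    show "finite J" by fact
    show "(\<lambda>\<omega>. SUP p\<in>P \<omega>. \<phi> y p) \<in> borel_measurable M" if "y \<in> J" for y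
      using that J by (intro borel_measurable_SUP_poisson_point_process[OF P] \<phi>) auto
    show "(\<lambda>\<omega>. SUP q\<in>Q \<omega>. \<psi> y q) \<in> borel_measurable N" if "y \<in> J" for y
      using that J by (intro borel_measurable_SUP_poisson_point_process[OF Q] \<psi>) auto
    fix x :: "'k \<Rightarrow> ennreal"
    have "measure M {\<omega> \<in> space M. \<forall>y\<in>J. (SUP p\<in>P \<omega>. \<phi> y p) \<le> x y} =
        (if emeasure \<mu> {p \<in> space \<mu>. \<exists>y\<in>J. x y < \<phi> y p} = \<infinity> then 0
         else exp (- measure \<mu> {p \<in> space \<mu>. \<exists>y\<in>J. x y < \<phi> y p}))"
      by (rule void[OF P]) (rule \<phi>)
    also have "\<dots> = (if emeasure \<nu> {q \<in> space \<nu>. \<exists>y\<in>J. x y < \<psi> y q} = \<infinity> then 0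
         else exp (- measure \<nu> {q \<in> space \<nu>. \<exists>y\<in>J. x y < \<psi> y q}))"
      \<comment> \<open>Once \<open>measure\<close> is unfolded, the case distinction and the
        exponent depend on the intensity through \<open>emeasure\<close> alone.\<close>
      by (simp only: measure_def eq[OF J])
    also have "\<dots> = measure N {\<omega> \<in> space N. \<forall>y\<in>J. (SUP q\<in>Q \<omega>. \<psi> y q) \<le> x y}"
      by (rule void[OF Q, symmetric]) (rule \<psi>)
    finally show "measure M {\<omega> \<in> space M. \<forall>y\<in>J. (SUP p\<in>P \<omega>. \<phi> y p) \<le> x y} =
        measure N {\<omega> \<in> space N. \<forall>y\<in>J. (SUP q\<in>Q \<omega>. \<psi> y q) \<le> x y}" .
  qed
qed

section \<open>The inverse square measure and its scaling\<close>

lemma space_inverse_square_measure [simp]: "space inverse_square_measure = {0<..}"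
  by (simp add: inverse_square_measure_def space_restrict_space)

lemma sets_inverse_square_measure [measurable_cong]:
  "sets inverse_square_measure = sets (restrict_space borel {0<..})"
  by (simp add: inverse_square_measure_def sets_restrict_space)

lemma nn_integral_inverse_square_measure:
  assumes [measurable]: "h \<in> borel_measurable borel"
  shows "(\<integral>\<^sup>+ t. h t \<partial>inverse_square_measure) =
    (\<integral>\<^sup>+ t. ennreal (1 / t\<^sup>2) * h t * indicator {0<..} t \<partial>lborel)"
  unfolding inverse_square_measure_def
  by (subst nn_integral_density)
     (simp_all add: nn_integral_restrict_space measurable_restrict_space1)

text \<open>The total mass is infinite near 0, but the density is finite at every point and Lebesgue
  measure on the half-line is sigma-finite. This makes iterated integration on the product with
  \<open>H\<close> available.\<close>

lemma sigma_finite_inverse_square_measure: "sigma_finite_measure inverse_square_measure"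
proof -
  interpret sigma_finite_measure "restrict_space lborel {0::real<..}"
    by (rule sigma_finite_measure_restrict_space) (simp_all add: lborel.sigma_finite_measure_axioms)
  show ?thesis
    unfolding inverse_square_measure_def
    by (subst sigma_finite_iff_density_finite) (auto intro!: measurable_restrict_space1)
qed

text \<open>Homogeneity of order -1: under \<open>t = c * s\<close>, the Jacobian \<open>c\<close>
  and the factor \<open>1 / c^2\<close> from the density combine to \<open>1 / c\<close>, which the
  prefactor cancels.\<close>

lemma nn_integral_inverse_square_measure_scale:
  fixes c :: real
  assumes h[measurable]: "h \<in> borel_measurable borel" and c: "c > 0"
  shows "ennreal c * (\<integral>\<^sup>+ t. h (t / c) \<partial>inverse_square_measure) =
    (\<integral>\<^sup>+ t. h t \<partial>inverse_square_measure)"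
proof -
  \<comment> \<open>The substitution is run from the right-hand side of the claim, as an affine map
    of slope \<open>1 / c\<close> and offset 0.\<close>
  have "(\<integral>\<^sup>+ t. h t \<partial>inverse_square_measure) =
      ennreal \<bar>1 / c\<bar> * (\<integral>\<^sup>+ t. ennreal (1 / (t / c)\<^sup>2) * h (t / c) * indicator {0<..} (t / c) \<partial>lborel)"
    using c by (subst nn_integral_inverse_square_measure[OF h],
      subst nn_integral_real_affine[where c = "1 / c" and t = 0]) auto
  also have "\<dots> = (\<integral>\<^sup>+ t. ennreal (1 / c) *
      (ennreal (1 / (t / c)\<^sup>2) * h (t / c) * indicator {0<..} (t / c)) \<partial>lborel)"
    using c by (subst nn_integral_cmult) auto
  also have "\<dots> = (\<integral>\<^sup>+ t. ennreal c * (ennreal (1 / t\<^sup>2) * h (t / c) * indicator {0<..} t) \<partial>lborel)"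
  proof (rule nn_integral_cong)
    fix t
    \<comment> \<open>This holds at \<open>t = 0\<close> as well, where division by zero makes both
      sides 0.\<close>
    have "ennreal (1 / c) * ennreal (1 / (t / c)\<^sup>2) = ennreal c * ennreal (1 / t\<^sup>2)"
      using c by (simp add: ennreal_mult[symmetric] power2_eq_square)
    moreover have "indicator {0<..} (t / c) = (indicator {0<..} t :: ennreal)"
      using c by (auto simp: indicator_def zero_less_divide_iff)
    ultimately show "ennreal (1 / c) * (ennreal (1 / (t / c)\<^sup>2) * h (t / c) * indicator {0<..} (t / c)) =
        ennreal c * (ennreal (1 / t\<^sup>2) * h (t / c) * indicator {0<..} t)"
      by (metis mult.assoc)
  qed
  also have "\<dots> = ennreal c * (\<integral>\<^sup>+ t. h (t / c) \<partial>inverse_square_measure)"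
    by (subst nn_integral_cmult) (auto simp: nn_integral_inverse_square_measure)
  finally show ?thesis ..
qed

section \<open>Sigma-finiteness of locally finite measures\<close>

lemma space_borel_of: "space (borel_of T) = topspace T"
  unfolding borel_of_def by (rule space_measure_of) (auto dest: openin_subset)

lemma openin_in_sets_borel_of: "openin T U \<Longrightarrow> U \<in> sets (borel_of T)"
  unfolding borel_of_def by (auto dest: openin_subset intro!: sigma_sets.Basic simp: sets_measure_of subset_eq)

text \<open>Open sets of finite measure cover the space, and second countability gives the Lindelof
  property, hence a countable subcover.\<close>

lemma sigma_finite_locally_finite_measure_on:
  assumes H: "locally_finite_measure_on T H" and T: "second_countable T"
  shows "sigma_finite_measure H"
proof -
  have sets: "sets H = sets (borel_of T)"
    using H by (simp add: locally_finite_measure_on_def)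
  let ?C = "{U. openin T U \<and> emeasure H U < \<infinity>}"
  have "\<Union>?C = topspace T"
  proof
    show "\<Union>?C \<subseteq> topspace T" by (auto dest: openin_subset)
    show "topspace T \<subseteq> \<Union>?C" using H unfolding locally_finite_measure_on_def by blast
  qed
  then obtain D where D: "countable D" "D \<subseteq> ?C" "\<Union>D = topspace T"
    using Lindelof_spaceD[OF second_countable_imp_Lindelof_space[OF T], of ?C] by auto
  have "space H = topspace T"
    using sets_eq_imp_space_eq[OF sets] space_borel_of by (rule trans)
  moreover have "D \<subseteq> sets H"
    using D(2) openin_in_sets_borel_of unfolding sets by blast
  moreover have "\<forall>U\<in>D. emeasure H U \<noteq> \<infinity>"
    using D(2) by fastforce
  ultimately show ?thesis
    by (intro sigma_finite_measure.intro exI[of _ D] conjI) (simp_all only: D)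
qed

section \<open>Comparison of the two intensities\<close>

theorem proposition2p1:
  fixes T :: "('k::polish_space \<Rightarrow> real) topology"
    and H :: "('k \<Rightarrow> real) measure"
    and g :: "('k \<Rightarrow> real) \<Rightarrow> real"
    and M :: "'w measure" and P :: "'w \<Rightarrow> (real \<times> ('k \<Rightarrow> real)) set"
    and N :: "'v measure" and Q :: "'v \<Rightarrow> (real \<times> ('k \<Rightarrow> real)) set"
    and Z :: "'k \<Rightarrow> 'w \<Rightarrow> ennreal"
  assumes "compact (UNIV :: 'k set)"
    and "polish_topology T"
    and "\<And>f y. f \<in> topspace T \<Longrightarrow> 0 \<le> f y"
    and "\<And>y. (\<lambda>f. f y) \<in> borel_measurable (borel_of T)"
    and "locally_finite_measure_on T H"
    and "\<And>y. (\<integral>\<^sup>+ f. ennreal (f y) \<partial>H) = 1"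
    and "poisson_point_process M P (inverse_square_measure \<Otimes>\<^sub>M H)"
    and "\<And>y \<omega>. Z y \<omega> = (SUP (t, f)\<in>P \<omega>. ennreal (t * f y))"
    and "g \<in> borel_measurable H"
    and "\<And>f. f \<in> topspace T \<Longrightarrow> 0 \<le> g f"
    and "(\<integral>\<^sup>+ f. ennreal (g f) \<partial>H) = 1"
    and "{f \<in> topspace T. g f = 0 \<and> (SUP y. ennreal (f y)) > 0} \<in> null_sets (completion H)"
    and "poisson_point_process N Q (inverse_square_measure \<Otimes>\<^sub>M density H (\<lambda>f. ennreal (g f)))"
  shows "eq_fdd UNIV M Z N (\<lambda>y \<omega>. SUP (t, f)\<in>Q \<omega>. ennreal (t * (f y / g f)))"
proof -
  note nonneg = assms(3) and P = assms(7) and [measurable] = assms(9)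
    and g_nonneg = assms(10) and Q = assms(13)
  have sets_H: "sets H = sets (borel_of T)"
    using assms(5) by (simp add: locally_finite_measure_on_def)
  have space_H: "space H = topspace T"
    using sets_eq_imp_space_eq[OF sets_H] by (simp add: space_borel_of)
  have eval[measurable]: "(\<lambda>f. f y) \<in> borel_measurable H" for y
    using assms(4)[of y] measurable_cong_sets[OF sets_H refl] by blast
  let ?I = inverse_square_measure and ?G = "density H (\<lambda>f. ennreal (g f))"
  interpret I: sigma_finite_measure ?I by (rule sigma_finite_inverse_square_measure)
  interpret H: sigma_finite_measure H
    using assms(2,5) sigma_finite_locally_finite_measure_on
    unfolding polish_topology_def by blast
  interpret G: finite_measure ?G
  proof (rule finite_measureI)
    have "emeasure ?G (space ?G) = (\<integral>\<^sup>+ f. ennreal (g f) * indicator (space H) f \<partial>H)"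
      by (simp add: emeasure_density)
    also have "\<dots> = (\<integral>\<^sup>+ f. ennreal (g f) \<partial>H)"
      by (intro nn_integral_cong) simp
    finally show "emeasure ?G (space ?G) \<noteq> \<infinity>"
      by (simp only: assms(11)) simp
  qed
  interpret IH: pair_sigma_finite ?I H ..
  interpret IG: pair_sigma_finite ?I ?G ..
  have id_I[measurable]: "(\<lambda>t. t) \<in> borel_measurable ?I"
    by (simp add: measurable_cong_sets[OF sets_inverse_square_measure refl] measurable_restrict_space1)
  \<comment> \<open>The supremum over all of \<open>K\<close> need not be measurable in
    \<open>f\<close>, so the exceptional set is null only for the completion; almost-everywhere
    statements transfer back to \<open>H\<close>. Outside it, \<open>f\<close> vanishes at all
    \<open>y\<close> simultaneously.\<close>
  have zero: "AE f in H. g f = 0 \<longrightarrow> (\<forall>y. f y = 0)"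
  proof -
    have "AE f in completion H. f \<notin> {f \<in> topspace T. g f = 0 \<and> (SUP y. ennreal (f y)) > 0}"
      by (rule AE_not_in[OF assms(12)])
    then have "AE f in H. f \<notin> {f \<in> topspace T. g f = 0 \<and> (SUP y. ennreal (f y)) > 0}"
      by (simp add: AE_completion_iff)
    then show ?thesis
    proof (rule AE_mp, intro AE_I2 impI allI)
      fix f y
      assume f: "f \<in> space H" "g f = 0"
        and "f \<notin> {f \<in> topspace T. g f = 0 \<and> (SUP y. ennreal (f y)) > 0}"
      then have "(SUP y. ennreal (f y)) = 0" by (simp add: space_H)
      then have "ennreal (f y) = 0" by (metis SUP_upper UNIV_I le_zero_eq)
      with nonneg[of f y] f show "f y = 0" by (simp add: space_H ennreal_eq_0_iff)
    qed
  qed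
  let ?\<phi> = "\<lambda>y (t, f). ennreal (t * f y)" and ?\<psi> = "\<lambda>y (t, f). ennreal (t * (f y / g f))"
  have "eq_fdd UNIV M (\<lambda>y \<omega>. SUP p\<in>P \<omega>. ?\<phi> y p) N (\<lambda>y \<omega>. SUP q\<in>Q \<omega>. ?\<psi> y q)"
  proof (rule eq_fdd_SUP_poisson_point_process[OF P Q])
    show \<phi>: "?\<phi> y \<in> borel_measurable (?I \<Otimes>\<^sub>M H)" for y by measurable
    show \<psi>: "?\<psi> y \<in> borel_measurable (?I \<Otimes>\<^sub>M ?G)" for y by measurable
    fix J :: "'k set" and x :: "'k \<Rightarrow> ennreal"
    assume J: "finite J"
    let ?A = "{p \<in> space (?I \<Otimes>\<^sub>M H). \<exists>y\<in>J. x y < ?\<phi> y p}"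
    let ?B = "{p \<in> space (?I \<Otimes>\<^sub>M ?G). \<exists>y\<in>J. x y < ?\<psi> y p}"
    have "?A = (\<Union>y\<in>J. {p \<in> space (?I \<Otimes>\<^sub>M H). x y < ?\<phi> y p})" by auto
    also have "\<dots> \<in> sets (?I \<Otimes>\<^sub>M H)"
      using J by (intro sets.finite_UN borel_measurable_less \<phi>) auto
    finally have A[measurable]: "?A \<in> sets (?I \<Otimes>\<^sub>M H)" .
    have "?B = (\<Union>y\<in>J. {p \<in> space (?I \<Otimes>\<^sub>M ?G). x y < ?\<psi> y p})" by auto
    also have "\<dots> \<in> sets (?I \<Otimes>\<^sub>M ?G)"
      using J by (intro sets.finite_UN borel_measurable_less \<psi>) auto
    finally have B[measurable]: "?B \<in> sets (?I \<Otimes>\<^sub>M ?G)" .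
    \<comment> \<open>A density does not change the sigma-algebra. This form is needed because the
      slice measures of \<open>?B\<close> are later integrated against \<open>H\<close>.\<close>
    have B': "?B \<in> sets (?I \<Otimes>\<^sub>M H)"
      using B by (simp cong: sets_pair_measure_cong)
    \<comment> \<open>The heights \<open>t\<close> at which \<open>t * f\<close> exceeds the level
      somewhere on \<open>J\<close>. It is defined on the whole real line, as the scaling lemma
      requires.\<close>
    let ?a = "\<lambda>f t. indicator {t. \<exists>y\<in>J. x y < ennreal (t * f y)} t :: ennreal"
    have a[measurable]: "?a f \<in> borel_measurable borel" for f
    proof -
      have "{t. \<exists>y\<in>J. x y < ennreal (t * f y)} = (\<Union>y\<in>J. {t. x y < ennreal (t * f y)})" by auto
      also have "\<dots> \<in> sets borel" using J by (intro sets.finite_UN) auto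
      finally show ?thesis by simp
    qed
    have sliceA: "emeasure ?I ((\<lambda>t. (t, f)) -` ?A) = (\<integral>\<^sup>+ t. ?a f t \<partial>?I)"
      if "f \<in> space H" for f
    proof -
      have "emeasure ?I ((\<lambda>t. (t, f)) -` ?A) = (\<integral>\<^sup>+ t. indicator ((\<lambda>t. (t, f)) -` ?A) t \<partial>?I)"
        using sets_Pair2[OF A] by simp
      also have "\<dots> = (\<integral>\<^sup>+ t. ?a f t \<partial>?I)"
        using that by (intro nn_integral_cong) (auto simp: indicator_def space_pair_measure)
      finally show ?thesis .
    qed
    \<comment> \<open>The factor \<open>g f\<close> moves from the function to the height:
      \<open>t * (f y / g f)\<close> equals \<open>(t / g f) * f y\<close>, also for
      \<open>g f = 0\<close> with division by zero.\<close>
    have sliceB: "emeasure ?I ((\<lambda>t. (t, f)) -` ?B) = (\<integral>\<^sup>+ t. ?a f (t / g f) \<partial>?I)"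
      if "f \<in> space H" for f
    proof -
      have "emeasure ?I ((\<lambda>t. (t, f)) -` ?B) = (\<integral>\<^sup>+ t. indicator ((\<lambda>t. (t, f)) -` ?B) t \<partial>?I)"
        using sets_Pair2[OF B] by simp
      also have "\<dots> = (\<integral>\<^sup>+ t. ?a f (t / g f) \<partial>?I)"
        using that by (intro nn_integral_cong) (auto simp: indicator_def space_pair_measure)
      finally show ?thesis .
    qed
    \<comment> \<open>The height is integrated first, with \<open>f\<close> fixed, so that
      \<open>g f\<close> becomes a constant factor in front of each slice.\<close>
    have "emeasure (?I \<Otimes>\<^sub>M ?G) ?B = (\<integral>\<^sup>+ f. emeasure ?I ((\<lambda>t. (t, f)) -` ?B) \<partial>?G)"
      by (rule IG.emeasure_pair_measure_alt2[OF B])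
    also have "\<dots> = (\<integral>\<^sup>+ f. ennreal (g f) * emeasure ?I ((\<lambda>t. (t, f)) -` ?B) \<partial>H)"
      by (rule nn_integral_density) (use IH.measurable_emeasure_Pair2[OF B'] in measurable)
    also have "\<dots> = (\<integral>\<^sup>+ f. emeasure ?I ((\<lambda>t. (t, f)) -` ?A) \<partial>H)"
    proof (rule nn_integral_cong_AE)
      show "AE f in H. ennreal (g f) * emeasure ?I ((\<lambda>t. (t, f)) -` ?B) =
          emeasure ?I ((\<lambda>t. (t, f)) -` ?A)"
        using zero AE_space
      proof eventually_elim
        case (elim f)
        show ?case
        \<comment> \<open>If \<open>g f = 0\<close>, the left side vanishes through its factor; on
          the right \<open>f\<close> is identically 0, and nothing in \<open>ennreal\<close> lies
          below 0, so the slice of \<open>?A\<close> is empty. Otherwise the scaling lemma applies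
          with \<open>c = g f\<close>.\<close>
        proof (cases "g f = 0")
          case True
          then show ?thesis using elim by (simp add: sliceA)
        next
          case False
          then have "g f > 0" using g_nonneg[of f] elim by (simp add: space_H)
          then show ?thesis
            using elim by (simp only: sliceA sliceB nn_integral_inverse_square_measure_scale[OF a])
        qed
      qed
    qed
    also have "\<dots> = emeasure (?I \<Otimes>\<^sub>M H) ?A"
      by (rule IH.emeasure_pair_measure_alt2[OF A, symmetric])
    finally show "emeasure (?I \<Otimes>\<^sub>M H) ?A = emeasure (?I \<Otimes>\<^sub>M ?G) ?B" ..
  qed
  moreover have "Z = (\<lambda>y \<omega>. SUP p\<in>P \<omega>. ?\<phi> y p)"
    using assms(8) by (intro ext)
  ultimately show ?thesis by simp
qed

end
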